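(* Let $0<p<1$, $0<q<1$, and let $(X_k)_{k\ge 0}$ be the random walk on $\mathbb{Z}$ perturbed at its global extrema with parameters $p,q$ (the walk with infinite memory, $L=\infty$), with $X_0=0$. For $n\ge 1$ let $\rho_n$ be the first time its range $\max_{0\le i\le k}X_i-\min_{0\le i\le k}X_i$ equals $n$, and let $Y_n=1$ if $X_{\rho_n}=\max_{0\le i\le \rho_n}X_i$ and $Y_n=0$ if $X_{\rho_n}=\min_{0\le i\le \rho_n}X_i$. Then $$\lim_{n\to\infty}\mathbb{P}(Y_n=1)=\frac{pq}{1-p-q+2pq}.$$
   Context: The walk with infinite memory: $(X_k)_{k\ge0}$ is a nearest-neighbour process on $\mathbb{Z}$ (each step is $\pm1$) such that, conditionally on the history $X_0,\dots,X_k$ with $X_k=x$, the probability that $X_{k+1}=x+1$ equals $p$ if $x=\max_{0\le i\le k}X_i$, equals $q$ if $x=\min_{0\le i\le k}X_i$, and equals $\tfrac12$ otherwise; $X_{k+1}=x-1$ with the complementary probability. If $x$ is both the maximum and the minimum (which happens only at $k=0$), the probability is $\tfrac12$. Notation: $\mathcal{M}(k)=\max_{0\le i\le k}X_i$, $\mathfrak{m}(k)=\min_{0\le i\le k}X_i$, range $\mathcal{R}(k)=\mathcal{M}(k)-\mathfrak{m}(k)$, and $\rho_n=\min\{k:\mathcal{R}(k)=n\}$. At time $\rho_n$ with $n\ge1$ the walk is at exactly one of $\mathcal{M}(\rho_n)$, $\mathfrak{m}(\rho_n)$. *)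

theory Defs
  imports "HOL-Probability.Probability"
begin

definition run_max :: "(nat \<Rightarrow> int) \<Rightarrow> nat \<Rightarrow> int" where
  "run_max x k = Max (x ` {..k})"

definition run_min :: "(nat \<Rightarrow> int) \<Rightarrow> nat \<Rightarrow> int" where
  "run_min x k = Min (x ` {..k})"

definition run_range :: "(nat \<Rightarrow> int) \<Rightarrow> nat \<Rightarrow> int" where
  "run_range x k = run_max x k - run_min x k"

text \<open>On paths whose range never equals \<open>n\<close> the value is unspecified; for the walk
  below with \<open>0 < p < 1\<close> and \<open>0 < q < 1\<close> such paths form a null set.\<close>

definition range_time :: "(nat \<Rightarrow> int) \<Rightarrow> nat \<Rightarrow> nat" where
  "range_time x n = (LEAST k. run_range x k = int n)"

text \<open>For \<open>n \<ge> 1\<close>, a nearest-neighbour path is at exactly one of its two running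
  extrema when its range first equals \<open>n\<close>, so the value 0 means being at the minimum.\<close>

definition at_max :: "(nat \<Rightarrow> int) \<Rightarrow> nat \<Rightarrow> nat" where
  "at_max x n =
     (if x (range_time x n) = run_max x (range_time x n) then 1 else 0)"

text \<open>Both \<open>p\<close> and \<open>q\<close> are probabilities of stepping \<^emph>\<open>up\<close>: a new maximum is set with
  probability \<open>p\<close>, a new minimum with probability \<open>1 - q\<close>.\<close>

definition up_prob :: "real \<Rightarrow> real \<Rightarrow> (nat \<Rightarrow> int) \<Rightarrow> nat \<Rightarrow> real" where
  "up_prob p q x k =
     (if x k = run_max x k \<and> x k = run_min x k then 1 / 2
      else if x k = run_max x k then p
      else if x k = run_min x k then q
      else 1 / 2)"

text \<open>The transition law is imposed on every history of positive probability. As the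
  two conditional probabilities sum to 1, the steps are almost surely \<open>1\<close> or \<open>-1\<close>.\<close>

locale infinite_memory_walk = prob_space M
  for M :: "'a measure" +
  fixes X :: "nat \<Rightarrow> 'a \<Rightarrow> int" and p q :: real
  assumes measurable_X: "\<And>k. X k \<in> measurable M (count_space UNIV)"
    and start: "AE \<omega> in M. X 0 \<omega> = 0"
    and step_up: "\<And>k x. \<P>(\<omega> in M. \<forall>i\<le>k. X i \<omega> = x i) > 0 \<Longrightarrow>
      \<P>(\<omega> in M. X (Suc k) \<omega> = x k + 1 \<bar> \<forall>i\<le>k. X i \<omega> = x i) = up_prob p q x k"
    and step_down: "\<And>k x. \<P>(\<omega> in M. \<forall>i\<le>k. X i \<omega> = x i) > 0 \<Longrightarrow>
      \<P>(\<omega> in M. X (Suc k) \<omega> = x k - 1 \<bar> \<forall>i\<le>k. X i \<omega> = x i) = 1 - up_prob p q x k"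

end

theory Submission
  imports Defs
begin

text \<open>
  Fix \<open>n \<ge> 1\<close>. While the range equals \<open>n\<close>, the conditional probability that it is next enlarged
  at the maximum is harmonic in the height above the minimum, hence affine, and the behaviour at
  the two extrema determines it. Optional stopping gives
  \<open>P(Y\<^sub>n\<^sub>+\<^sub>1 = 1) - L = \<kappa>n / (\<kappa>n + \<gamma>) * (P(Y\<^sub>n = 1) - L)\<close> with \<open>\<kappa> = p * (1 - q)\<close>,
  \<open>\<gamma> = 1 - p - q + 2 * p * q\<close> and \<open>L = p * q / \<gamma>\<close>. The product of these factors vanishes because
  the harmonic series diverges.

  Stopping times are avoided: the expectation at a fixed time \<open>k\<close> of a stopped martingale is
  computed, and the event that the range is still at most \<open>n\<close> disappears as \<open>k\<close> tends to infinity.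
\<close>

subsection \<open>Extrema and range of a path\<close>

definition rel_height :: "(nat \<Rightarrow> int) \<Rightarrow> nat \<Rightarrow> int" where
  "rel_height x k = x k - run_min x k"

text \<open>Only the first \<open>k\<close> steps are constrained, because the paths generated below
  are padded with 0 after time \<open>k\<close>.\<close>

definition nearest_neighbour :: "(nat \<Rightarrow> int) \<Rightarrow> nat \<Rightarrow> bool" where
  "nearest_neighbour x k \<longleftrightarrow> (\<forall>i<k. \<bar>x (Suc i) - x i\<bar> = 1)"

lemma run_max_cong: "(\<And>i. i \<le> k \<Longrightarrow> x i = y i) \<Longrightarrow> run_max x k = run_max y k"
  unfolding run_max_def by (intro arg_cong[where f=Max] image_cong) auto

lemma run_min_cong: "(\<And>i. i \<le> k \<Longrightarrow> x i = y i) \<Longrightarrow> run_min x k = run_min y k"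
  unfolding run_min_def by (intro arg_cong[where f=Min] image_cong) auto

lemma run_range_cong: "(\<And>i. i \<le> k \<Longrightarrow> x i = y i) \<Longrightarrow> run_range x k = run_range y k"
  unfolding run_range_def using run_max_cong[of k x y] run_min_cong[of k x y] by simp

lemma run_max_0 [simp]: "run_max x 0 = x 0"
  and run_min_0 [simp]: "run_min x 0 = x 0"
  by (simp_all add: run_max_def run_min_def)

lemma run_max_Suc: "run_max x (Suc k) = max (x (Suc k)) (run_max x k)"
  unfolding run_max_def atMost_Suc by (simp add: Max_insert)

lemma run_min_Suc: "run_min x (Suc k) = min (x (Suc k)) (run_min x k)"
  unfolding run_min_def atMost_Suc by (simp add: Min_insert)

lemma le_run_max: "x k \<le> run_max x k"
  unfolding run_max_def by (intro Max_ge) auto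

lemma run_min_le: "run_min x k \<le> x k"
  unfolding run_min_def by (intro Min_le) auto

lemma run_range_0 [simp]: "run_range x 0 = 0"
  by (simp add: run_range_def)

lemma mono_run_range: "mono (run_range x)"
  by (rule mono_iff_le_Suc[THEN iffD2])
     (auto simp: run_range_def run_max_Suc run_min_Suc)

lemma run_range_Suc_le:
  assumes "nearest_neighbour x (Suc k)"
  shows "run_range x (Suc k) \<le> run_range x k + 1"
proof -
  have "\<bar>x (Suc k) - x k\<bar> = 1" using assms by (auto simp: nearest_neighbour_def)
  then show ?thesis
    using le_run_max[of x k] run_min_le[of x k]
    by (auto simp: run_range_def run_max_Suc run_min_Suc)
qed

lemma nearest_neighbour_mono:
  "nearest_neighbour x k \<Longrightarrow> i \<le> k \<Longrightarrow> nearest_neighbour x i"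
  by (auto simp: nearest_neighbour_def)

text \<open>A discrete intermediate value argument: the range starts at 0 and no step raises it by
  more than 1.\<close>

lemma run_range_attains:
  assumes "nearest_neighbour x k" "int n \<le> run_range x k"
  shows "\<exists>i\<le>k. run_range x i = int n"
  using assms
proof (induction k)
  case (Suc k)
  show ?case
  proof (cases "int n \<le> run_range x k")
    case True
    then show ?thesis
      using Suc nearest_neighbour_mono[OF Suc.prems(1), of k] by (meson le_SucI le_refl lessI less_imp_le)
  next
    case False
    then show ?thesis
      using Suc.prems run_range_Suc_le[of x k] by (intro exI[of _ "Suc k"]) auto
  qed
qed auto

lemma range_time_le:
  assumes "nearest_neighbour x k" "int n \<le> run_range x k"
  shows "range_time x n \<le> k"
proof -
  obtain i where "i \<le> k" "run_range x i = int n" using run_range_attains[OF assms] by blast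
  then show ?thesis unfolding range_time_def using Least_le[of "\<lambda>k. run_range x k = int n" i] by simp
qed

text \<open>The \<open>LEAST\<close> in \<open>range_time\<close> searches the whole path, but once
  the range has reached \<open>n\<close> by time \<open>k\<close>, the first \<open>k\<close> steps
  decide it. This allows \<open>at_max\<close> to be evaluated on finite histories.\<close>

lemma range_time_cong:
  assumes "nearest_neighbour x k" "int n \<le> run_range x k" "\<And>i. i \<le> k \<Longrightarrow> x i = y i"
  shows "range_time y n = range_time x n"
proof -
  have y: "run_range y i = run_range x i" if "i \<le> k" for i
    using that assms(3) by (intro run_range_cong) auto
  obtain i where i: "i \<le> k" "run_range x i = int n" using run_range_attains[OF assms(1,2)] by blast
  have le: "range_time x n \<le> k" by (rule range_time_le[OF assms(1,2)])
  have at: "run_range x (range_time x n) = int n"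
    unfolding range_time_def using i(2) by (rule LeastI)
  show ?thesis unfolding range_time_def[of y]
  proof (rule Least_equality)
    show "run_range y (range_time x n) = int n" using le y at by simp
    fix l assume l: "run_range y l = int n"
    show "range_time x n \<le> l"
    proof (cases "l \<le> k")
      case True
      then have "run_range x l = int n" using l y by simp
      then show ?thesis unfolding range_time_def by (rule Least_le)
    qed (use le in auto)
  qed
qed

lemma at_max_cong:
  assumes "nearest_neighbour x k" "int n \<le> run_range x k" "\<And>i. i \<le> k \<Longrightarrow> x i = y i"
  shows "at_max y n = at_max x n"
proof -
  have le: "range_time x n \<le> k" by (rule range_time_le[OF assms(1,2)])
  then show ?thesis
    unfolding at_max_def
    using run_max_cong[of "range_time x n" x y] assms(3) range_time_cong[OF assms] by auto
qed

lemma range_time_eqI: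
  assumes "run_range x k < int n" "run_range x (Suc k) = int n"
  shows "range_time x n = Suc k"
  unfolding range_time_def
proof (rule Least_equality)
  fix l assume "run_range x l = int n"
  with assms(1) have "run_range x k < run_range x l" by simp
  then show "Suc k \<le> l"
    using monoD[OF mono_run_range, of l k x] by (meson linorder_not_le not_less_eq_eq)
qed (use assms in simp)

section \<open>Effect of a single step on range and height\<close>

lemma run_range_up: "run_range (x(Suc k := x k + 1)) (Suc k) =
    (if x k = run_max x k then run_range x k + 1 else run_range x k)"
  and rel_height_up: "rel_height (x(Suc k := x k + 1)) (Suc k) = rel_height x k + 1"
  and run_range_down: "run_range (x(Suc k := x k - 1)) (Suc k) =
    (if x k = run_min x k then run_range x k + 1 else run_range x k)"
  and rel_height_down: "rel_height (x(Suc k := x k - 1)) (Suc k) =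
    (if x k = run_min x k then 0 else rel_height x k - 1)"
  and run_max_upd: "run_max (x(Suc k := v)) (Suc k) = max v (run_max x k)"
proof -
  have "run_max (x(Suc k := v)) k = run_max x k" "run_min (x(Suc k := v)) k = run_min x k" for v
    by (auto intro: run_max_cong run_min_cong)
  then show "run_range (x(Suc k := x k + 1)) (Suc k) =
      (if x k = run_max x k then run_range x k + 1 else run_range x k)"
    "rel_height (x(Suc k := x k + 1)) (Suc k) = rel_height x k + 1"
    "run_range (x(Suc k := x k - 1)) (Suc k) =
      (if x k = run_min x k then run_range x k + 1 else run_range x k)"
    "rel_height (x(Suc k := x k - 1)) (Suc k) = (if x k = run_min x k then 0 else rel_height x k - 1)"
    "run_max (x(Suc k := v)) (Suc k) = max v (run_max x k)"
    using le_run_max[of x k] run_min_le[of x k]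
    by (auto simp: run_range_def rel_height_def run_max_Suc run_min_Suc)
qed

lemma rel_height_bounds: "0 \<le> rel_height x k" "rel_height x k \<le> run_range x k"
  using le_run_max[of x k] run_min_le[of x k] by (auto simp: rel_height_def run_range_def)

lemma eq_run_max_iff: "x k = run_max x k \<longleftrightarrow> rel_height x k = run_range x k"
  and eq_run_min_iff: "x k = run_min x k \<longleftrightarrow> rel_height x k = 0"
  by (auto simp: rel_height_def run_range_def)

lemma at_max_up:
  assumes "x k = run_max x k" "run_range x k + 1 = int n"
  shows "at_max (x(Suc k := x k + 1)) n = 1"
proof -
  have "run_range (x(Suc k := x k + 1)) k = run_range x k" by (rule run_range_cong) auto
  then have "range_time (x(Suc k := x k + 1)) n = Suc k"
    using assms run_range_up[of x k] by (intro range_time_eqI) auto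
  then show ?thesis using assms by (simp add: at_max_def run_max_upd)
qed

lemma at_max_down:
  assumes "x k = run_min x k" "run_range x k + 1 = int n"
  shows "at_max (x(Suc k := x k - 1)) n = 0"
proof -
  have "run_range (x(Suc k := x k - 1)) k = run_range x k" by (rule run_range_cong) auto
  then have "range_time (x(Suc k := x k - 1)) n = Suc k"
    using assms run_range_down[of x k] by (intro range_time_eqI) auto
  then show ?thesis using le_run_max[of x k] by (simp add: at_max_def run_max_upd)
qed

section \<open>Harmonic exit probabilities and the associated martingale\<close>

text \<open>The probability \<open>h j\<close> that the walk, having range \<open>n\<close> and sitting at height \<open>j\<close> above its
  minimum, next enlarges its range at the maximum: the solution of
  \<open>h n = p + (1 - p) * h (n - 1)\<close> and \<open>h 0 = q * h 1\<close> that is affine in \<open>j\<close>.\<close>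

definition exit_max_prob :: "real \<Rightarrow> real \<Rightarrow> nat \<Rightarrow> int \<Rightarrow> real" where
  "exit_max_prob p q n j =
     (p * q + p * (1 - q) * of_int j) / (p * (1 - q) * real n + (1 - p - q + 2 * p * q))"

text \<open>A martingale started when the range reaches \<open>n\<close> and frozen when it reaches \<open>n + 1\<close>; the
  subtracted term is the conditional mean of \<open>at_max x (n + 1)\<close> given \<open>at_max x n\<close>.\<close>

definition residual :: "real \<Rightarrow> real \<Rightarrow> nat \<Rightarrow> (nat \<Rightarrow> int) \<Rightarrow> nat \<Rightarrow> real" where
  "residual p q n x k =
     (if run_range x k < int n then 0
      else (if run_range x k = int n then exit_max_prob p q n (rel_height x k)
            else real (at_max x (Suc n)))
           - exit_max_prob p q n (if at_max x n = 1 then int n else 0))"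

text \<open>The conditional expectation of \<open>g\<close> given the history \<open>x\<close> up to
  time \<open>k\<close>, written for a deterministic path so that the martingale and drift
  computations involve no probability space.\<close>

definition step_mean :: "real \<Rightarrow> real \<Rightarrow> ((nat \<Rightarrow> int) \<Rightarrow> real) \<Rightarrow> nat \<Rightarrow> (nat \<Rightarrow> int) \<Rightarrow> real" where
  "step_mean p q g k x = up_prob p q x k * g (x(Suc k := x k + 1))
     + (1 - up_prob p q x k) * g (x(Suc k := x k - 1))"

text \<open>Range and height carry all the information about the next step; range 0 is the case in
  which the two extrema coincide.\<close>

lemma up_prob_rel_height: "up_prob p q x k =
     (if run_range x k = 0 then 1 / 2
      else if rel_height x k = run_range x k then p
      else if rel_height x k = 0 then q
      else 1 / 2)"
  using rel_height_bounds[of x k] unfolding up_prob_def eq_run_max_iff eq_run_min_iff by auto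

lemma denom_pos:
  fixes p q :: real
  assumes "0 < p" "p < 1" "0 < q" "q < 1"
  shows "0 < 1 - p - q + 2 * p * q" "0 < p * (1 - q) * real n + (1 - p - q + 2 * p * q)"
proof -
  \<comment> \<open>This sum is the expanded form \<open>1 - p - q + 2 * p * q\<close>.\<close>
  have "0 < p * q + (1 - p) * (1 - q)" using assms by (intro add_pos_pos mult_pos_pos) auto
  then show "0 < 1 - p - q + 2 * p * q" by (simp add: algebra_simps)
  then show "0 < p * (1 - q) * real n + (1 - p - q + 2 * p * q)"
    using assms by (intro add_nonneg_pos[OF mult_nonneg_nonneg]) auto
qed

text \<open>The equations at the maximum, at the minimum and in between. The one at the minimum
  fixes the ratio of the constant \<open>p * q\<close> to the slope \<open>p * (1 - q)\<close>; the
  one at the maximum then forces the denominator.\<close>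

lemma exit_max_prob_harmonic:
  assumes "0 < p" "p < 1" "0 < q" "q < 1"
  shows "p + (1 - p) * exit_max_prob p q n (int n - 1) = exit_max_prob p q n (int n)"
    "q * exit_max_prob p q n 1 = exit_max_prob p q n 0"
    "(exit_max_prob p q n (j + 1) + exit_max_prob p q n (j - 1)) / 2 = exit_max_prob p q n j"
  using denom_pos(2)[OF assms, of n] unfolding exit_max_prob_def
  by (auto simp: divide_simps) (auto simp: algebra_simps)

text \<open>The martingale property. The four cases are: range \<open>n\<close> out of reach,
  reachable in this step, current, and exceeded. With \<open>1 \<le> n\<close> the two extrema are
  distinct at range \<open>n\<close>.\<close>

lemma step_mean_residual:
  assumes pq: "0 < p" "p < 1" "0 < q" "q < 1" and n: "1 \<le> n" and x: "nearest_neighbour x k"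
  shows "step_mean p q (\<lambda>y. residual p q n y (Suc k)) k x = residual p q n x k"
proof -
  let ?u = "x(Suc k := x k + 1)" and ?d = "x(Suc k := x k - 1)"
  let ?r = "run_range x k" and ?j = "rel_height x k"
  have cong: "at_max (x(Suc k := v)) m = at_max x m" if "int m \<le> ?r" for v m
    using that by (intro at_max_cong[OF x]) auto
  note stp = run_range_up rel_height_up run_range_down rel_height_down
  note hm = exit_max_prob_harmonic[OF pq, of n]
  consider "?r + 1 < int n" | "?r + 1 = int n" | "?r = int n" | "int n < ?r" by linarith
  then show ?thesis
  proof cases
    case 1
    then show ?thesis by (simp add: step_mean_def residual_def stp)
  next
    case 2
    \<comment> \<open>A step that brings the range to \<open>n\<close> ends at an extremum, at
      height \<open>n\<close> or 0 in agreement with \<open>at_max\<close>, so the two values of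
      \<open>exit_max_prob\<close> cancel.\<close>
    have u: "residual p q n ?u (Suc k) = 0"
      using 2 at_max_up[of x k n]
      by (auto simp: residual_def stp eq_run_max_iff[of x k])
    have d: "residual p q n ?d (Suc k) = 0"
      using 2 at_max_down[of x k n] by (auto simp: residual_def stp)
    show ?thesis using 2 by (simp add: step_mean_def u d) (simp add: residual_def)
  next
    case 3
    let ?c = "exit_max_prob p q n (if at_max x n = 1 then int n else 0)"
    \<comment> \<open>Only a step beyond an extremum replaces \<open>exit_max_prob\<close> by the
      outcome 1 or 0; \<open>?c\<close> was settled when the range reached \<open>n\<close>.\<close>
    have u: "residual p q n ?u (Suc k) =
      (if ?j = int n then 1 else exit_max_prob p q n (?j + 1)) - ?c"
      using 3 cong[of n] at_max_up[of x k "Suc n"]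
      by (auto simp: residual_def stp eq_run_max_iff[of x k] eq_run_min_iff[of x k])
    have d: "residual p q n ?d (Suc k) =
      (if ?j = 0 then 0 else exit_max_prob p q n (?j - 1)) - ?c"
      using 3 cong[of n] at_max_down[of x k "Suc n"]
      by (auto simp: residual_def stp eq_run_max_iff[of x k] eq_run_min_iff[of x k])
    have res: "residual p q n x k = exit_max_prob p q n ?j - ?c" using 3 by (simp add: residual_def)
    consider "?j = int n" | "?j = 0" "?j \<noteq> int n" | "?j \<noteq> 0" "?j \<noteq> int n" by blast
    then show ?thesis
    proof cases
      case 1
      then show ?thesis using 3 n hm(1) unfolding step_mean_def u d res
        by (simp add: up_prob_rel_height algebra_simps)
    next
      case 2
      then show ?thesis using 3 n hm(2) unfolding step_mean_def u d res
        by (simp add: up_prob_rel_height algebra_simps)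
    next
      case interior: 3
      then show ?thesis using \<open>?r = int n\<close> n hm(3)[of ?j] unfolding step_mean_def u d res
        by (simp add: up_prob_rel_height algebra_simps)
    qed
  next
    case 4
    \<comment> \<open>Both \<open>at_max\<close> values are already decided at time
      \<open>k\<close>, so the residual is frozen.\<close>
    then have "residual p q n (x(Suc k := v)) (Suc k) = residual p q n x k"
      if "v = x k + 1 \<or> v = x k - 1" for v
    proof -
      have "int n < run_range (x(Suc k := v)) (Suc k)"
        using 4 that by (auto simp: stp)
      then show ?thesis using 4 cong[of n v] cong[of "Suc n" v] by (simp add: residual_def)
    qed
    then show ?thesis by (simp add: step_mean_def algebra_simps)
  qed
qed

section \<open>Escape from a bounded range\<close>

text \<open>With \<open>K\<close> large, a single up-step has enough weight to double the mean of
  \<open>K ^ rel_height\<close>, so the walk cannot keep its range at most \<open>n\<close> for long.\<close>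

definition lyapunov :: "real \<Rightarrow> nat \<Rightarrow> (nat \<Rightarrow> int) \<Rightarrow> nat \<Rightarrow> real" where
  "lyapunov K n x k = (if run_range x k \<le> int n then K ^ nat (rel_height x k) else K ^ Suc n)"

lemma lyapunov_bounds:
  assumes "1 \<le> K" shows "0 \<le> lyapunov K n x k" "lyapunov K n x k \<le> K ^ Suc n"
  using assms rel_height_bounds[of x k] by
    (auto simp: lyapunov_def simp del: power_Suc intro!: power_increasing)

lemma up_prob_ge:
  assumes "0 < p" "p < 1" "0 < q" "q < 1"
  shows "min (1 / 2) (min p q) \<le> up_prob p q x k" "up_prob p q x k \<le> 1"
  using assms by (auto simp: up_prob_def)

text \<open>While the range is at most \<open>n\<close>, an up-step has probability at least
  \<open>2 / K\<close> and multiplies the value \<open>y \<ge> 1\<close> by \<open>K\<close>; the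
  down-step contributes a nonnegative amount. So the mean is at least \<open>2 * y\<close>, hence at
  least \<open>y + 1\<close>.\<close>

lemma step_mean_lyapunov:
  assumes pq: "0 < p" "p < 1" "0 < q" "q < 1" and K: "K = 2 / min (1 / 2) (min p q)"
  shows "lyapunov K n x k + of_bool (run_range x k \<le> int n)
    \<le> step_mean p q (\<lambda>y. lyapunov K n y (Suc k)) k x"
proof -
  let ?c = "min (1 / 2) (min p q)"
  have c: "0 < ?c" "?c \<le> 1/2" using pq by auto
  have cK: "?c * K = 2"
    using c(1) unfolding K by (metis less_irrefl nonzero_mult_div_cancel_left times_divide_eq_right)
  have K1: "1 \<le> K" using c unfolding K by (simp add: divide_simps)
  note u = up_prob_ge[OF pq, of x k]
  show ?thesis
  proof (cases "run_range x k \<le> int n")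
    case True
    have h: "nat (rel_height x k + 1) = Suc (nat (rel_height x k))" "Suc (nat (rel_height x k)) \<le> Suc n"
      using rel_height_bounds[of x k] True by auto
    have "lyapunov K n x k + 1 \<le> 2 * K ^ nat (rel_height x k)"
      using True one_le_power[OF K1, of "nat (rel_height x k)"] by (simp add: lyapunov_def)
    also have "\<dots> = ?c * K ^ Suc (nat (rel_height x k))" unfolding power_Suc mult.assoc[symmetric] cK ..
    also have "\<dots> \<le> up_prob p q x k * lyapunov K n (x(Suc k := x k + 1)) (Suc k)"
    proof (rule mult_mono)
      show "K ^ Suc (nat (rel_height x k)) \<le> lyapunov K n (x(Suc k := x k + 1)) (Suc k)"
        using power_increasing[OF h(2) K1] h by (auto simp: lyapunov_def rel_height_up simp del: power_Suc)
    qed (use u c K1 in auto)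
    also have "\<dots> \<le> step_mean p q (\<lambda>y. lyapunov K n y (Suc k)) k x"
      unfolding step_mean_def using u lyapunov_bounds(1)[OF K1] by simp
    finally show ?thesis using True by simp
  next
    case False
    have stay: "lyapunov K n (x(Suc k := v)) (Suc k) = K ^ Suc n"
      if "v = x k + 1 \<or> v = x k - 1" for v
    proof -
      have "\<not> run_range (x(Suc k := v)) (Suc k) \<le> int n"
        using False that by (auto simp: run_range_up run_range_down split: if_splits)
      then show ?thesis by (simp add: lyapunov_def)
    qed
    have "lyapunov K n x k = K ^ Suc n" using False by (simp add: lyapunov_def)
    then show ?thesis
      using False stay[of "x k + 1"] stay[of "x k - 1"] by (simp add: step_mean_def algebra_simps)
  qed
qed

subsection \<open>The law of the walk up to a fixed time\<close>

definition walk_step :: "real \<Rightarrow> real \<Rightarrow> nat \<Rightarrow> (nat \<Rightarrow> int) \<Rightarrow> (nat \<Rightarrow> int) pmf" where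
  "walk_step p q k x =
     map_pmf (\<lambda>b. x(Suc k := x k + (if b then 1 else -1))) (bernoulli_pmf (up_prob p q x k))"

text \<open>An explicit model of the walk up to time \<open>k\<close>. Its paths are total functions
  that vanish after time \<open>k\<close>, so the support is finite and every expectation is a
  finite sum.\<close>

fun walk_pmf :: "real \<Rightarrow> real \<Rightarrow> nat \<Rightarrow> (nat \<Rightarrow> int) pmf" where
  "walk_pmf p q 0 = return_pmf (\<lambda>_. 0)"
| "walk_pmf p q (Suc k) = bind_pmf (walk_pmf p q k) (walk_step p q k)"

text \<open>Pads a history with the same default 0 as \<open>walk_pmf\<close>, so that an infinite
  path can be compared with an atom of that distribution.\<close>

definition truncated_path :: "nat \<Rightarrow> (nat \<Rightarrow> int) \<Rightarrow> nat \<Rightarrow> int" where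
  "truncated_path k x i = (if i \<le> k then x i else 0)"

lemma finite_set_walk_step: "finite (set_pmf (walk_step p q k x))"
  by (simp add: walk_step_def)

lemma finite_set_walk_pmf: "finite (set_pmf (walk_pmf p q k))"
  by (induction k) (simp_all add: finite_set_walk_step)

lemma integrable_walk_pmf [simp]: "integrable (measure_pmf (walk_pmf p q k)) (f :: _ \<Rightarrow> real)"
  by (rule integrable_measure_pmf_finite[OF finite_set_walk_pmf])

lemma set_walk_pmf:
  "x \<in> set_pmf (walk_pmf p q k) \<Longrightarrow> nearest_neighbour x k \<and> truncated_path k x = x"
proof (induction k arbitrary: x)
  case 0
  then show ?case by (auto simp: nearest_neighbour_def truncated_path_def)
next
  case (Suc k)
  then obtain y b where y: "y \<in> set_pmf (walk_pmf p q k)"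
    and x: "x = y(Suc k := y k + (if b then 1 else -1))"
    by (auto simp: walk_step_def)
  have "nearest_neighbour y k" and s: "\<And>i. truncated_path k y i = y i" using Suc.IH[OF y] by auto
  moreover have "y i = 0" if "\<not> i \<le> k" for i using s[of i] that by (simp add: truncated_path_def)
  ultimately show ?case
    unfolding x by (auto simp: nearest_neighbour_def truncated_path_def less_Suc_eq fun_eq_iff)
qed

lemma expectation_walk_Suc:
  assumes "0 < p" "p < 1" "0 < q" "q < 1"
  shows "measure_pmf.expectation (walk_pmf p q (Suc k)) g
    = measure_pmf.expectation (walk_pmf p q k) (step_mean p q g k)"
proof -
  have u: "0 \<le> up_prob p q x k" "up_prob p q x k \<le> 1" for x
    using up_prob_ge[OF assms, of x k] assms by auto
  have "measure_pmf.expectation (walk_step p q k x) g = step_mean p q g k x" for x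
    using u[of x] by (simp add: walk_step_def step_mean_def)
  then show ?thesis
    by (simp add: pmf_expectation_bind[OF finite_set_walk_pmf[of p q k] finite_set_walk_step order_refl]
        integral_measure_pmf[OF finite_set_walk_pmf[of p q k]])
qed

text \<open>At time 0 the range is below \<open>n\<close> and the residual is 0; the martingale
  property keeps its mean there.\<close>

lemma expectation_residual:
  assumes "0 < p" "p < 1" "0 < q" "q < 1" "1 \<le> n"
  shows "measure_pmf.expectation (walk_pmf p q k) (\<lambda>x. residual p q n x k) = 0"
proof (induction k)
  case 0
  then show ?case using assms by (simp add: residual_def)
next
  case (Suc k)
  have "measure_pmf.expectation (walk_pmf p q (Suc k)) (\<lambda>x. residual p q n x (Suc k)) =
    measure_pmf.expectation (walk_pmf p q k) (\<lambda>x. residual p q n x k)"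
    unfolding expectation_walk_Suc[OF assms(1-4)]
    by (intro integral_cong_AE)
       (auto simp: AE_measure_pmf_iff intro!: step_mean_residual[OF assms] dest: set_walk_pmf)
  with Suc show ?case by simp
qed

text \<open>Each step raises the mean of \<open>lyapunov\<close> by at least the probability in
  question, while this mean never exceeds \<open>K ^ Suc n\<close>. The probabilities are therefore
  summable.\<close>

lemma range_le_tendsto_0:
  assumes pq: "0 < p" "p < 1" "0 < q" "q < 1"
  shows "(\<lambda>k. measure_pmf.prob (walk_pmf p q k) {x. run_range x k \<le> int n}) \<longlonglongrightarrow> 0"
proof -
  define K where "K = 2 / min (1 / 2) (min p q)"
  have K: "1 \<le> K" using pq unfolding K_def by (auto simp: divide_simps)
  let ?E = "\<lambda>k. measure_pmf.expectation (walk_pmf p q k)"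
  let ?t = "\<lambda>k. measure_pmf.prob (walk_pmf p q k) {x. run_range x k \<le> int n}"
  have t: "?t k = ?E k (\<lambda>x. of_bool (run_range x k \<le> int n))" for k
  proof -
    have "?t k = ?E k (indicator {x. run_range x k \<le> int n})" by simp
    also have "indicator {x. run_range x k \<le> int n} = (\<lambda>x. of_bool (run_range x k \<le> int n) :: real)"
      by (auto simp: indicator_def)
    finally show ?thesis .
  qed
  have inc: "?E k (\<lambda>x. lyapunov K n x k) + ?t k \<le> ?E (Suc k) (\<lambda>x. lyapunov K n x (Suc k))" for k
    unfolding t expectation_walk_Suc[OF pq]
    unfolding Bochner_Integration.integral_add[OF integrable_walk_pmf integrable_walk_pmf, symmetric]
    by (intro integral_mono integrable_walk_pmf step_mean_lyapunov[OF pq K_def])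
  have "(\<Sum>i<k. ?t i) \<le> ?E k (\<lambda>x. lyapunov K n x k)" for k
  proof (induction k)
    case 0
    then show ?case by (simp add: lyapunov_bounds(1)[OF K])
  next
    case (Suc k)
    then show ?case using inc[of k] by simp
  qed
  also have "?E k (\<lambda>x. lyapunov K n x k) \<le> K ^ Suc n" for k
    by (intro measure_pmf.integral_le_const)
       (auto simp: AE_measure_pmf_iff lyapunov_bounds(2)[OF K] simp del: power_Suc)
  finally have "summable ?t"
    by (intro summableI_nonneg_bounded[where x="K ^ Suc n"]) auto
  then show ?thesis by (rule summable_LIMSEQ_zero)
qed

text \<open>A step changes coordinate \<open>Suc k\<close> alone, so the only possible predecessor
  of \<open>y\<close> is its truncation and the mixture over predecessors has a single term.\<close>

lemma pmf_walk_Suc: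
  "pmf (walk_pmf p q (Suc k)) y =
    pmf (walk_pmf p q k) (truncated_path k y) * pmf (walk_step p q k (truncated_path k y)) y"
proof -
  let ?z = "truncated_path k y"
  have "pmf (walk_pmf p q (Suc k)) y =
      measure_pmf.expectation (walk_pmf p q k) (\<lambda>x. pmf (walk_step p q k x) y)"
    by (simp add: pmf_bind)
  also have "\<dots> = measure_pmf.expectation (walk_pmf p q k)
      (\<lambda>x. indicator {?z} x * pmf (walk_step p q k ?z) y)"
  proof (intro integral_cong_AE; (simp add: AE_measure_pmf_iff)?)
    show "\<forall>x\<in>set_pmf (walk_pmf p q k).
        pmf (walk_step p q k x) y = indicator {?z} x * pmf (walk_step p q k ?z) y"
    proof
      fix x assume x: "x \<in> set_pmf (walk_pmf p q k)"
      show "pmf (walk_step p q k x) y = indicator {?z} x * pmf (walk_step p q k ?z) y"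
      proof (cases "y \<in> set_pmf (walk_step p q k x)")
        case True
        then have "truncated_path k y = truncated_path k x" by (auto simp: walk_step_def truncated_path_def fun_eq_iff)
        then show ?thesis using set_walk_pmf[OF x] by simp
      next
        case False
        then show ?thesis by (auto simp: indicator_def pmf_eq_0_set_pmf)
      qed
    qed
  qed
  finally show ?thesis by (simp add: measure_pmf_single)
qed

lemma pmf_walk_step:
  assumes "0 < p" "p < 1" "0 < q" "q < 1" "\<And>i. i \<noteq> Suc k \<Longrightarrow> y i = x i"
  shows "pmf (walk_step p q k x) y =
    (if y (Suc k) = x k + 1 then up_prob p q x k
     else if y (Suc k) = x k - 1 then 1 - up_prob p q x k else 0)"
proof -
  have u: "0 \<le> up_prob p q x k" "up_prob p q x k \<le> 1"
    using up_prob_ge[OF assms(1-4), of x k] assms by auto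
  let ?f = "\<lambda>b. x(Suc k := x k + (if b then 1 else -1))"
  \<comment> \<open>By injectivity each path in the image carries the mass of exactly one Bernoulli
    outcome.\<close>
  have inj: "inj ?f" by (auto simp: inj_on_def fun_eq_iff split: if_splits)
  consider "y (Suc k) = x k + 1" | "y (Suc k) = x k - 1" | "y (Suc k) \<noteq> x k + 1" "y (Suc k) \<noteq> x k - 1"
    by blast
  then show ?thesis
  proof cases
    case 1
    then have y: "y = ?f True" using assms(5) by auto
    show ?thesis using 1 u pmf_map_inj'[OF inj, of "bernoulli_pmf (up_prob p q x k)" True]
      unfolding walk_step_def y[symmetric] by simp
  next
    case 2
    then have y: "y = ?f False" using assms(5) by auto
    show ?thesis using 2 u pmf_map_inj'[OF inj, of "bernoulli_pmf (up_prob p q x k)" False]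
      unfolding walk_step_def y[symmetric] by simp
  next
    case 3
    then have "y \<notin> set_pmf (walk_step p q k x)" by (auto simp: walk_step_def split: if_splits)
    then show ?thesis using 3 by (simp add: pmf_eq_0_set_pmf)
  qed
qed

section \<open>Transfer from the explicit model to an arbitrary walk\<close>

context infinite_memory_walk
begin

declare measurable_X [measurable]

lemma measurable_history [measurable]: "Measurable.pred M (\<lambda>\<omega>. \<forall>i\<le>k. X i \<omega> = x i)"
  by measurable

text \<open>The locale prescribes only conditional laws; multiplying them along a history determines
  every finite-dimensional law, which justifies computing in the explicit model.\<close>

lemma prob_history:
  assumes pq: "0 < p" "p < 1" "0 < q" "q < 1"
  shows "\<P>(\<omega> in M. \<forall>i\<le>k. X i \<omega> = x i) = pmf (walk_pmf p q k) (truncated_path k x)"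
proof (induction k)
  case 0
  have "\<P>(\<omega> in M. X 0 \<omega> = x 0) = (if x 0 = 0 then 1 else 0)"
  proof (cases "x 0 = 0")
    case True
    then show ?thesis using start by (simp add: prob_Collect_eq_1)
  next
    case False
    then have "AE \<omega> in M. X 0 \<omega> \<noteq> x 0" using start by auto
    then show ?thesis using False by (simp add: prob_Collect_eq_0)
  qed
  then show ?case by (auto simp: truncated_path_def fun_eq_iff pmf_return)
next
  case (Suc k)
  let ?H = "\<lambda>\<omega>. \<forall>i\<le>k. X i \<omega> = x i" and ?z = "truncated_path k x"
  let ?h = "\<P>(\<omega> in M. ?H \<omega>)"
  have up: "up_prob p q ?z k = up_prob p q x k"
    using run_max_cong[of k ?z x] run_min_cong[of k ?z x] by (auto simp: up_prob_def truncated_path_def)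
  have split: "(\<forall>i\<le>Suc k. X i \<omega> = x i) \<longleftrightarrow> X (Suc k) \<omega> = x (Suc k) \<and> ?H \<omega>" for \<omega>
    by (auto simp: le_Suc_eq)
  have joint: "\<P>(\<omega> in M. X (Suc k) \<omega> = v \<and> ?H \<omega>) =
      (if v = x k + 1 then up_prob p q x k
       else if v = x k - 1 then 1 - up_prob p q x k else 0) * ?h" for v
  proof (cases "?h = 0")
    \<comment> \<open>A null history has no prescribed conditional law, but then both sides
      vanish.\<close>
    case True
    have "\<P>(\<omega> in M. X (Suc k) \<omega> = v \<and> ?H \<omega>) \<le> ?h"
      by (intro finite_measure_mono) auto
    then show ?thesis using True by (simp add: measure_le_0_iff)
  next
    case False
    then have pos: "?h > 0" by (simp add: zero_less_measure_iff)
    have u: "\<P>(\<omega> in M. X (Suc k) \<omega> = x k + 1 \<and> ?H \<omega>) = up_prob p q x k * ?h"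
      using step_up[OF pos] pos by (simp add: cond_prob_def divide_simps)
    have d: "\<P>(\<omega> in M. X (Suc k) \<omega> = x k - 1 \<and> ?H \<omega>) = (1 - up_prob p q x k) * ?h"
      using step_down[OF pos] pos by (simp add: cond_prob_def divide_simps)
    \<comment> \<open>The two unit steps already exhaust the mass \<open>?h\<close> of the history,
      leaving none for a third value.\<close>
    have o: "\<P>(\<omega> in M. X (Suc k) \<omega> = v \<and> ?H \<omega>) = 0" if "v \<noteq> x k + 1" "v \<noteq> x k - 1"
    proof -
      let ?A = "\<lambda>v. {\<omega>\<in>space M. X (Suc k) \<omega> = v \<and> ?H \<omega>}"
      have "prob (?A (x k + 1)) + prob (?A (x k - 1)) + prob (?A v) =
          prob (?A (x k + 1) \<union> ?A (x k - 1) \<union> ?A v)"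
        using that by (subst finite_measure_Union; (subst finite_measure_Union)?) auto
      also have "\<dots> \<le> ?h"
        by (intro finite_measure_mono) auto
      finally have "up_prob p q x k * ?h + (1 - up_prob p q x k) * ?h + prob (?A v) \<le> ?h"
        unfolding u d .
      moreover have "c * h + (1 - c) * h = h" for c h :: real by (simp add: algebra_simps)
      ultimately have "prob (?A v) \<le> 0" by simp
      then show ?thesis by (simp add: measure_le_0_iff)
    qed
    show ?thesis using u d o by auto
  qed
  have "truncated_path k (truncated_path (Suc k) x) = ?z" by (auto simp: truncated_path_def)
  moreover have "truncated_path (Suc k) x i = ?z i" if "i \<noteq> Suc k" for i
    using that by (auto simp: truncated_path_def)
  ultimately show ?case
    unfolding split joint pmf_walk_Suc Suc.IH
    by (subst pmf_walk_step[OF pq]) (auto simp: up, auto simp: truncated_path_def)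
qed

text \<open>The support is finite, so the event is a finite disjoint union of history events; this
  gives measurability and probability together.\<close>

lemma prob_truncated_path:
  assumes pq: "0 < p" "p < 1" "0 < q" "q < 1" and A: "A \<subseteq> set_pmf (walk_pmf p q k)"
  shows "Measurable.pred M (\<lambda>\<omega>. truncated_path k (\<lambda>i. X i \<omega>) \<in> A)" (is ?meas)
    and "\<P>(\<omega> in M. truncated_path k (\<lambda>i. X i \<omega>) \<in> A) = measure_pmf.prob (walk_pmf p q k) A" (is ?prob)
proof -
  let ?H = "\<lambda>x. {\<omega>\<in>space M. truncated_path k (\<lambda>i. X i \<omega>) = x}"
  have fin: "finite A" using A finite_set_walk_pmf finite_subset by blast
  have fixed: "truncated_path k x = x" if "x \<in> A" for x
    using that A set_walk_pmf by blast
  have iff: "truncated_path k (\<lambda>i. X i \<omega>) = x \<longleftrightarrow> (\<forall>i\<le>k. X i \<omega> = x i)" if "x \<in> A" for x \<omega>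
    using fixed[OF that] unfolding truncated_path_def fun_eq_iff by metis
  have set: "{\<omega>\<in>space M. truncated_path k (\<lambda>i. X i \<omega>) \<in> A} = (\<Union>x\<in>A. ?H x)"
    by auto
  have H: "?H x = {\<omega>\<in>space M. \<forall>i\<le>k. X i \<omega> = x i}" if "x \<in> A" for x
    using iff[OF that] by simp
  then have sets: "?H x \<in> sets M" if "x \<in> A" for x
    using that by simp
  have "disjoint_family_on ?H A"
    by (auto simp: disjoint_family_on_def)
  then have "prob (\<Union>x\<in>A. ?H x) = (\<Sum>x\<in>A. prob (?H x))"
    using fin sets by (intro finite_measure_finite_Union) auto
  also have "\<dots> = measure_pmf.prob (walk_pmf p q k) A"
    using fin fixed by (simp add: H prob_history[OF pq] measure_measure_pmf_finite)
  finally show ?prob unfolding set .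
  have "(\<Union>x\<in>A. ?H x) \<in> sets M" using fin sets by auto
  then show ?meas unfolding pred_def set .
qed

lemma AE_truncated_path:
  assumes pq: "0 < p" "p < 1" "0 < q" "q < 1"
  shows "AE \<omega> in M. truncated_path k (\<lambda>i. X i \<omega>) \<in> set_pmf (walk_pmf p q k)"
  using prob_truncated_path[OF pq order_refl, of k]
  by (intro prob_Collect_eq_1[THEN iffD1]) (auto simp: measure_pmf.prob_eq_1 AE_measure_pmf_iff pred_def)

lemma measurable_run_max [measurable]: "(\<lambda>\<omega>. run_max (\<lambda>k. X k \<omega>) k) \<in> measurable M (count_space UNIV)"
proof (induction k)
  case (Suc k)
  have "(\<lambda>\<omega>. max (X (Suc k) \<omega>) (run_max (\<lambda>k. X k \<omega>) k)) \<in> measurable M (count_space UNIV)"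
    by (rule measurable_compose_countable[where g="X (Suc k)" and f="\<lambda>i \<omega>. max i (run_max (\<lambda>k. X k \<omega>) k)"])
       (auto intro: measurable_compose[OF Suc])
  then show ?case by (simp add: run_max_Suc)
qed simp

lemma measurable_run_min [measurable]: "(\<lambda>\<omega>. run_min (\<lambda>k. X k \<omega>) k) \<in> measurable M (count_space UNIV)"
proof (induction k)
  case (Suc k)
  have "(\<lambda>\<omega>. min (X (Suc k) \<omega>) (run_min (\<lambda>k. X k \<omega>) k)) \<in> measurable M (count_space UNIV)"
    by (rule measurable_compose_countable[where g="X (Suc k)" and f="\<lambda>i \<omega>. min i (run_min (\<lambda>k. X k \<omega>) k)"])
       (auto intro: measurable_compose[OF Suc])
  then show ?case by (simp add: run_min_Suc)
qed simp

lemma measurable_at_max [measurable]: "Measurable.pred M (\<lambda>\<omega>. at_max (\<lambda>k. X k \<omega>) n = 1)"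
proof -
  have "(\<lambda>\<omega>. run_range (\<lambda>k. X k \<omega>) k) \<in> measurable M (count_space UNIV)" for k
    unfolding run_range_def
    by (rule measurable_compose_countable[where g="\<lambda>\<omega>. run_max (\<lambda>k. X k \<omega>) k"
          and f="\<lambda>i \<omega>. i - run_min (\<lambda>k. X k \<omega>) k"])
       (auto intro: measurable_compose[OF measurable_run_min])
  note [measurable] = this
  have [measurable]: "(\<lambda>\<omega>. range_time (\<lambda>k. X k \<omega>) n) \<in> measurable M (count_space UNIV)"
    unfolding range_time_def by measurable
  \<comment> \<open>The time is random but has countably many values, so fixed times
    suffice.\<close>
  have "Measurable.pred M (\<lambda>\<omega>. X (range_time (\<lambda>k. X k \<omega>) n) \<omega> =
      run_max (\<lambda>k. X k \<omega>) (range_time (\<lambda>k. X k \<omega>) n))"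
    by (rule measurable_compose_countable[where g="\<lambda>\<omega>. range_time (\<lambda>k. X k \<omega>) n"
          and f="\<lambda>i \<omega>. X i \<omega> = run_max (\<lambda>k. X k \<omega>) i"]) measurable
  then show ?thesis by (simp add: at_max_def)
qed

text \<open>The first \<open>k\<close> steps decide \<open>at_max\<close> unless the range is still
  small, so the two probabilities differ by at most that of range at most \<open>n\<close>, which
  tends to 0.\<close>

lemma walk_at_max_tendsto:
  assumes pq: "0 < p" "p < 1" "0 < q" "q < 1"
  shows "(\<lambda>k. measure_pmf.prob (walk_pmf p q k) {x. at_max x n = 1})
    \<longlonglongrightarrow> \<P>(\<omega> in M. at_max (\<lambda>k. X k \<omega>) n = 1)"
proof -
  let ?P = "\<P>(\<omega> in M. at_max (\<lambda>k. X k \<omega>) n = 1)"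
  let ?W = "\<lambda>k. measure_pmf.prob (walk_pmf p q k)"
  have "\<bar>?W k {x. at_max x n = 1} - ?P\<bar> \<le> ?W k {x. run_range x k \<le> int n}" for k
  proof -
    let ?S = "set_pmf (walk_pmf p q k)" and ?T = "\<lambda>\<omega>. truncated_path k (\<lambda>i. X i \<omega>)"
    define A where "A = {x. at_max x n = 1} \<inter> ?S"
    define B where "B = {x. run_range x k \<le> int n} \<inter> ?S"
    note A = prob_truncated_path[OF pq, of A k] and B = prob_truncated_path[OF pq, of B k]
    have [measurable]: "Measurable.pred M (\<lambda>\<omega>. ?T \<omega> \<in> A)" "Measurable.pred M (\<lambda>\<omega>. ?T \<omega> \<in> B)"
      using A(1) B(1) by (auto simp: A_def B_def)
    have PA: "\<P>(\<omega> in M. ?T \<omega> \<in> A) = ?W k {x. at_max x n = 1}"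
      using A(2) unfolding A_def by (simp add: measure_Int_set_pmf)
    have PB: "\<P>(\<omega> in M. ?T \<omega> \<in> B) = ?W k {x. run_range x k \<le> int n}"
      using B(2) unfolding B_def by (simp add: measure_Int_set_pmf)
    have key: "AE \<omega> in M. ?T \<omega> \<notin> B \<longrightarrow> (?T \<omega> \<in> A \<longleftrightarrow> at_max (\<lambda>k. X k \<omega>) n = 1)"
      using AE_truncated_path[OF pq, of k]
    proof eventually_elim
      case (elim \<omega>)
      have "at_max (\<lambda>k. X k \<omega>) n = at_max (?T \<omega>) n" if "?T \<omega> \<notin> B"
        using elim that set_walk_pmf[OF elim]
        by (intro at_max_cong[of _ k]) (auto simp: B_def truncated_path_def)
      then show ?case using elim by (auto simp: A_def)
    qed
    have union: "\<P>(\<omega> in M. Q \<omega> \<or> ?T \<omega> \<in> B) \<le> \<P>(\<omega> in M. Q \<omega>) + \<P>(\<omega> in M. ?T \<omega> \<in> B)"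
      if [measurable]: "Measurable.pred M Q" for Q
    proof -
      have "{\<omega>\<in>space M. Q \<omega> \<or> ?T \<omega> \<in> B} = {\<omega>\<in>space M. Q \<omega>} \<union> {\<omega>\<in>space M. ?T \<omega> \<in> B}"
        by auto
      then show ?thesis by (simp add: measure_Un_le)
    qed
    have "?P \<le> \<P>(\<omega> in M. ?T \<omega> \<in> A \<or> ?T \<omega> \<in> B)"
      by (intro finite_measure_mono_AE) (use key in \<open>auto simp del: One_nat_def\<close>)
    moreover have "\<P>(\<omega> in M. ?T \<omega> \<in> A) \<le> \<P>(\<omega> in M. at_max (\<lambda>k. X k \<omega>) n = 1 \<or> ?T \<omega> \<in> B)"
      by (intro finite_measure_mono_AE) (use key in \<open>auto simp del: One_nat_def\<close>)
    ultimately show ?thesis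
      using union[of "\<lambda>\<omega>. ?T \<omega> \<in> A"] union[OF measurable_at_max[of n]] PA PB
      by (simp add: abs_le_iff)
  qed
  then have "(\<lambda>k. ?W k {x. at_max x n = 1} - ?P) \<longlonglongrightarrow> 0"
    by (intro Lim_null_comparison[OF _ range_le_tendsto_0[OF pq, of n]]) auto
  then show ?thesis by (rule LIM_zero_cancel)
qed

end

subsection \<open>The recurrence in the range\<close>

lemma exit_max_prob_bounds:
  assumes pq: "0 < p" "p < 1" "0 < q" "q < 1" and "0 \<le> j" "j \<le> int n"
  shows "0 \<le> exit_max_prob p q n j" "exit_max_prob p q n j \<le> 1"
proof -
  note D = denom_pos(2)[OF pq, of n]
  show "0 \<le> exit_max_prob p q n j"
    using D assms by (auto simp: exit_max_prob_def intro!: divide_nonneg_pos add_nonneg_nonneg)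
  have "p * (1 - q) * of_int j \<le> p * (1 - q) * real n"
    using assms by (intro mult_left_mono) auto
  \<comment> \<open>This product is the gap between \<open>p * q\<close> and
    \<open>1 - p - q + 2 * p * q\<close>.\<close>
  moreover have "0 \<le> (1 - p) * (1 - q)" using pq by simp
  then have "p * q \<le> 1 - p - q + 2 * p * q" by (simp add: algebra_simps)
  ultimately show "exit_max_prob p q n j \<le> 1"
    using D by (simp add: exit_max_prob_def)
qed

text \<open>Once the range exceeds \<open>n\<close>, the residual is exactly the defect of the
  recurrence; before that, the two differ by at most 1. Since the residual has mean 0, the error is
  at most the probability that the range is at most \<open>n\<close>.\<close>

lemma walk_at_max_recurrence:
  assumes pq: "0 < p" "p < 1" "0 < q" "q < 1" and n: "1 \<le> n"
  shows "\<bar>measure_pmf.prob (walk_pmf p q k) {x. at_max x (Suc n) = 1}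
      - (exit_max_prob p q n 0 + (exit_max_prob p q n (int n) - exit_max_prob p q n 0)
          * measure_pmf.prob (walk_pmf p q k) {x. at_max x n = 1})\<bar>
    \<le> measure_pmf.prob (walk_pmf p q k) {x. run_range x k \<le> int n}"
proof -
  let ?E = "measure_pmf.expectation (walk_pmf p q k)"
  let ?h = "exit_max_prob p q n"
  let ?I = "\<lambda>m. indicator {x. at_max x m = 1} :: _ \<Rightarrow> real"
  let ?J = "indicator {x. run_range x k \<le> int n} :: _ \<Rightarrow> real"
  let ?D = "\<lambda>x. ?I (Suc n) x - (?h 0 + (?h (int n) - ?h 0) * ?I n x) - residual p q n x k"
  have pointwise: "\<bar>?D x\<bar> \<le> ?J x" for x
  proof -
    \<comment> \<open>The two-valued starting term is affine in the indicator of
      \<open>at_max x n = 1\<close>, so taking means makes it affine in the probability.\<close>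
    define c where "c = ?h (if at_max x n = 1 then int n else 0)"
    have c: "?h 0 + (?h (int n) - ?h 0) * ?I n x = c"
      by (simp add: c_def indicator_def)
    define i where "i = ?I (Suc n) x"
    have I: "real (at_max x (Suc n)) = i" "0 \<le> i" "i \<le> 1"
      by (auto simp: i_def indicator_def at_max_def)
    have "0 \<le> c" "c \<le> 1"
      unfolding c_def using exit_max_prob_bounds[OF pq, of _ n] by auto
    moreover have "0 \<le> ?h (rel_height x k)" "?h (rel_height x k) \<le> 1" if "run_range x k = int n"
      using exit_max_prob_bounds[OF pq, of _ n] rel_height_bounds[of x k] that by auto
    moreover have "?J x = of_bool (run_range x k \<le> int n)" by (simp add: indicator_def)
    ultimately show ?thesis
      using I(2,3) unfolding c residual_def I(1) c_def[symmetric] i_def[symmetric]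
      by (cases "run_range x k = int n") (auto simp: abs_le_iff)
  qed
  have "?E ?D = ?E (?I (Suc n)) - (?h 0 + (?h (int n) - ?h 0) * ?E (?I n))"
    using expectation_residual[OF pq n, of k] by simp
  moreover have "\<bar>?E ?D\<bar> \<le> ?E ?J"
    using pointwise by (intro order.trans[OF integral_abs_bound integral_mono]) auto
  ultimately show ?thesis by simp
qed

lemma (in infinite_memory_walk) at_max_recurrence:
  assumes pq: "0 < p" "p < 1" "0 < q" "q < 1" and n: "1 \<le> n"
  shows "\<P>(\<omega> in M. at_max (\<lambda>k. X k \<omega>) (Suc n) = 1)
    = exit_max_prob p q n 0 + (exit_max_prob p q n (int n) - exit_max_prob p q n 0)
        * \<P>(\<omega> in M. at_max (\<lambda>k. X k \<omega>) n = 1)"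
proof -
  let ?W = "\<lambda>k m. measure_pmf.prob (walk_pmf p q k) {x. at_max x m = 1}"
  let ?R = "\<lambda>k. ?W k (Suc n) - (exit_max_prob p q n 0
    + (exit_max_prob p q n (int n) - exit_max_prob p q n 0) * ?W k n)"
  have "?R \<longlonglongrightarrow> 0"
    using walk_at_max_recurrence[OF pq n]
    by (intro Lim_null_comparison[OF _ range_le_tendsto_0[OF pq, of n]]) auto
  moreover have "?R \<longlonglongrightarrow> \<P>(\<omega> in M. at_max (\<lambda>k. X k \<omega>) (Suc n) = 1) - (exit_max_prob p q n 0
    + (exit_max_prob p q n (int n) - exit_max_prob p q n 0) * \<P>(\<omega> in M. at_max (\<lambda>k. X k \<omega>) n = 1))"
    by (intro tendsto_intros walk_at_max_tendsto[OF pq])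
  ultimately show ?thesis using LIMSEQ_unique by fastforce
qed

section \<open>Convergence of the recurrence\<close>

text \<open>For large \<open>N\<close> the \<open>N\<close>-th power of each factor is at most
  \<open>n / (n + 1)\<close>. These bounds telescope, so \<open>\<bar>d n\<bar> ^ N\<close> is at
  most a constant over \<open>n\<close>.\<close>

lemma tendsto_0_of_contraction:
  fixes d :: "nat \<Rightarrow> real"
  assumes "0 < \<kappa>" "0 < \<gamma>"
    and d: "\<And>n. 1 \<le> n \<Longrightarrow> d (Suc n) = \<kappa> * real n / (\<kappa> * real n + \<gamma>) * d n"
  shows "d \<longlonglongrightarrow> 0"
proof -
  \<comment> \<open>This choice gives \<open>N * \<gamma> / (\<kappa> * n) > 1 / n\<close>, which is
    what Bernoulli's inequality turns into the bound on the factor.\<close>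
  obtain N :: nat where N: "\<kappa> / \<gamma> < real N" using reals_Archimedean2 by blast
  then have N0: "0 < N" using assms by (metis divide_pos_pos gr0I less_asym of_nat_0)
  have factor: "(\<kappa> * real n / (\<kappa> * real n + \<gamma>)) ^ N \<le> real n / real (Suc n)" if n: "1 \<le> n" for n
  proof -
    let ?x = "\<gamma> / (\<kappa> * real n)"
    have x: "0 < ?x" using assms n by simp
    have "real (Suc n) / real n \<le> 1 + real N * ?x"
      using N n assms by (simp add: field_simps)
    also have "\<dots> \<le> (1 + ?x) ^ N" using x by (intro Bernoulli_inequality) simp
    finally have "inverse ((1 + ?x) ^ N) \<le> inverse (real (Suc n) / real n)"
      using n by (intro le_imp_inverse_le) auto
    moreover have "\<kappa> * real n / (\<kappa> * real n + \<gamma>) = inverse (1 + ?x)"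
      using assms n by (simp add: field_simps add_pos_pos)
    ultimately show ?thesis by (simp add: power_inverse)
  qed
  have bound: "real n * \<bar>d n\<bar> ^ N \<le> \<bar>d 1\<bar> ^ N" if "1 \<le> n" for n
    using that
  proof (induction n rule: dec_induct)
    case (step n)
    have "real (Suc n) * \<bar>d (Suc n)\<bar> ^ N
      = real (Suc n) * ((\<kappa> * real n / (\<kappa> * real n + \<gamma>)) ^ N * \<bar>d n\<bar> ^ N)"
      using assms step.hyps by (simp add: d abs_mult power_mult_distrib[symmetric])
    also have "\<dots> \<le> real (Suc n) * (real n / real (Suc n) * \<bar>d n\<bar> ^ N)"
      using step.hyps by (intro mult_left_mono mult_right_mono factor) auto
    also have "\<dots> = real n * \<bar>d n\<bar> ^ N" by simp
    finally show ?case using step.IH by simp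
  qed simp
  have "(\<lambda>n. \<bar>d n\<bar> ^ N) \<longlonglongrightarrow> 0"
  proof (rule Lim_null_comparison)
    show "(\<lambda>n. \<bar>d 1\<bar> ^ N / real n) \<longlonglongrightarrow> 0" by (rule lim_const_over_n)
    show "\<forall>\<^sub>F n in sequentially. norm (\<bar>d n\<bar> ^ N) \<le> \<bar>d 1\<bar> ^ N / real n"
      using bound by (intro eventually_sequentiallyI[of 1]) (auto simp: field_simps)
  qed
  then show ?thesis using N0 by (simp add: power_tendsto_0_iff tendsto_rabs_zero_iff)
qed

theorem proposition1:
  fixes M :: "'a measure" and X :: "nat \<Rightarrow> 'a \<Rightarrow> int" and p q :: real
  assumes "0 < p" "p < 1" "0 < q" "q < 1"
    and "infinite_memory_walk M X p q"
  shows "(\<lambda>n. \<P>(\<omega> in M. at_max (\<lambda>k. X k \<omega>) n = 1))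
    \<longlonglongrightarrow> p * q / (1 - p - q + 2 * p * q)"
proof -
  interpret infinite_memory_walk M X p q by fact
  note pq = assms(1-4)
  let ?P = "\<lambda>n. \<P>(\<omega> in M. at_max (\<lambda>k. X k \<omega>) n = 1)"
  define \<gamma> where "\<gamma> = 1 - p - q + 2 * p * q"
  define \<kappa> where "\<kappa> = p * (1 - q)"
  have \<gamma>: "0 < \<gamma>" using denom_pos(1)[OF pq] by (simp add: \<gamma>_def)
  have \<kappa>: "0 < \<kappa>" using pq by (simp add: \<kappa>_def)
  have "?P (Suc n) - p * q / \<gamma> = \<kappa> * real n / (\<kappa> * real n + \<gamma>) * (?P n - p * q / \<gamma>)"
    if "1 \<le> n" for n
  proof -
    have D: "\<kappa> * real n + \<gamma> > 0" using \<gamma> \<kappa> by (simp add: add_nonneg_pos)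
    have "?P (Suc n) = p * q / (\<kappa> * real n + \<gamma>) + \<kappa> * real n / (\<kappa> * real n + \<gamma>) * ?P n"
      using at_max_recurrence[OF pq that]
      by (simp add: exit_max_prob_def \<gamma>_def[symmetric] \<kappa>_def[symmetric] add_divide_distrib)
    \<comment> \<open>The limit \<open>p * q / \<gamma>\<close> is a fixed point of the affine
      recurrence for every \<open>n\<close>, so subtracting it leaves a purely linear one.\<close>
    moreover have "p * q / (\<kappa> * real n + \<gamma>) - p * q / \<gamma> = - (\<kappa> * real n / (\<kappa> * real n + \<gamma>) * (p * q / \<gamma>))"
      using D \<gamma> by (simp add: divide_simps) (simp add: algebra_simps)
    ultimately show ?thesis by (simp add: right_diff_distrib)
  qed
  from tendsto_0_of_contraction[of \<kappa> \<gamma> "\<lambda>n. ?P n - p * q / \<gamma>", OF \<kappa> \<gamma> this]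
  show ?thesis unfolding \<gamma>_def by (rule LIM_zero_cancel)
qed

end
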